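(* Let $\alpha_1,\ldots,\alpha_s\in\overline{\mathbb{Q}}\setminus\{0,1\}$ (roots of unity being allowed), and let $q_{ij}\in\mathbb{Z}[\alpha_i]$ for $1\le i\le s$, $1\le j\le k$, be such that for every $j$ there is some $i$ with $q_{ij}\ne 0$. Then the set of all $(x_1,\ldots,x_k)\in\mathbb{Z}^k$ satisfying $$q_{i1}\alpha_i^{x_1}+\cdots+q_{ik}\alpha_i^{x_k}=0\qquad\text{for all } i=1,\ldots,s$$ is semilinear.
   Context: $\overline{\mathbb{Q}}$ is an algebraic closure of $\mathbb{Q}$. A set $S\subseteq\mathbb{Z}^k$ is called semilinear here if it is a finite (possibly empty) union of cosets of subgroups of $\mathbb{Z}^k$, i.e. $S=\bigcup_{i=1}^n(\overline{\delta}_i+A_i)$ for some $\overline{\delta}_1,\ldots,\overline{\delta}_n\in\mathbb{Z}^k$ and subgroups $A_1,\ldots,A_n\le\mathbb{Z}^k$. Coefficients $q_{ij}$ are of the form $\sum_{h=0}^{d_i-1}r_{ij}^h\alpha_i^h$ with $r_{ij}^h\in\mathbb{Z}$, where $d_i$ is the degree of $\alpha_i$ over $\mathbb{Q}$. *)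

theory Defs
  imports
    Complex_Main
    "HOL-Computational_Algebra.Polynomial"
    "HOL-Algebra.Coset"
    "HOL-Algebra.Product_Groups"
begin

text \<open>
  The algebraic closure of the rationals, realised as the algebraic numbers inside the
  complex numbers.
\<close>

definition Qbar :: "complex set" where
  "Qbar = {z. algebraic z}"

text \<open>
  The ring generated by \<open>a\<close> over the integers. The degree of the integer polynomials is not
  bounded: unless \<open>a\<close> is an algebraic integer, polynomials of degree below the degree of \<open>a\<close>
  do not suffice.
\<close>

definition int_adjoin :: "complex \<Rightarrow> complex set" where
  "int_adjoin a = {poly (map_poly of_int p) a | p :: int poly. True}"

text \<open>
  Elements of the additive group of integer \<open>k\<close>-tuples are the functions on \<open>{1..k}\<close>,
  \<open>undefined\<close> elsewhere; the group operation, written multiplicatively in HOL-Algebra, is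
  componentwise addition.
\<close>

definition int_tuples :: "nat \<Rightarrow> (nat \<Rightarrow> int) monoid" where
  "int_tuples k = product_group {1..k} (\<lambda>_. integer_group)"

text \<open>
  A finite union of cosets of arbitrary subgroups; \<open>n = 0\<close> gives the empty set. This is not
  the notion of semilinearity based on submonoids of tuples of natural numbers.
\<close>

definition semilinear :: "nat \<Rightarrow> (nat \<Rightarrow> int) set \<Rightarrow> bool" where
  "semilinear k S \<longleftrightarrow>
    (\<exists>(n::nat) (\<delta> :: nat \<Rightarrow> nat \<Rightarrow> int) (A :: nat \<Rightarrow> (nat \<Rightarrow> int) set).
      (\<forall>i\<in>{1..n}. \<delta> i \<in> carrier (int_tuples k)) \<and>
      (\<forall>i\<in>{1..n}. subgroup (A i) (int_tuples k)) \<and>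
      S = (\<Union>i\<in>{1..n}. \<delta> i <#\<^bsub>int_tuples k\<^esub> A i))"

end

theory Submission
  imports Defs "HOL-Computational_Algebra.Computational_Algebra"
begin

text \<open>
  Finite unions of cosets are closed under intersection, so a single equation
  \<open>\<Sum>j. q j * z powi x j = 0\<close> suffices. If \<open>z ^ n = 1\<close>, its solution set is closed under
  translation by \<open>n \<int>\<^sup>k\<close>. Otherwise \<open>z\<close> or \<open>inverse z\<close> is small at some place of
  \<open>\<rat>(z)\<close>: if the minimal polynomial has a non-unit constant or leading coefficient,
  a prime dividing that coefficient provides a finite place; if both are units, Kronecker's
  theorem provides a conjugate off the unit circle. Smallness implies that in a solution with a
  large gap between the exponents the terms on each side of the gap sum to zero. Hence every
  solution splits into vanishing subsums within which the exponents differ by a bounded amount,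
  and translating each of these blocks by its own integer gives a coset of solutions; only finitely
  many such cosets occur.
\<close>

section \<open>Minimal integer polynomials\<close>

definition ieval :: "int poly \<Rightarrow> 'a :: field_char_0 \<Rightarrow> 'a" where
  "ieval p z = poly (map_poly of_int p) z"

lemma ieval_pCons: "ieval (pCons a p) z = of_int a + z * ieval p z"
  by (simp add: ieval_def map_poly_pCons)

lemma ieval_0 [simp]: "ieval 0 z = 0"
  by (simp add: ieval_def)

lemma ieval_const [simp]: "ieval [:a:] z = of_int a"
  by (simp add: ieval_pCons)

lemma ieval_add [simp]: "ieval (p + q) z = ieval p z + ieval q z"
  by (induction p q rule: poly_induct2) (simp_all add: ieval_pCons algebra_simps)

lemma ieval_smult [simp]: "ieval (smult a p) z = of_int a * ieval p z"
  by (induction p) (simp_all add: ieval_pCons algebra_simps)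

lemma ieval_minus [simp]: "ieval (- p) z = - ieval p z"
  using ieval_smult[of "-1" p z] by simp

lemma ieval_diff [simp]: "ieval (p - q) z = ieval p z - ieval q z"
  using ieval_add[of p "- q" z] by simp

lemma ieval_mult [simp]: "ieval (p * q) z = ieval p z * ieval q z"
  by (induction p) (simp_all add: ieval_pCons algebra_simps)

lemma ieval_sum [simp]: "ieval (sum f A) z = (\<Sum>x\<in>A. ieval (f x) z)"
  by (induction A rule: infinite_finite_induct) simp_all

lemma ieval_monom [simp]: "ieval (monom a n) z = of_int a * z ^ n"
  by (simp add: ieval_def map_poly_monom poly_monom)

lemma ieval_reflect_poly:
  "z \<noteq> 0 \<Longrightarrow> ieval (reflect_poly p) z = z ^ degree p * ieval p (inverse z)"
proof (induction p)
  case (pCons a p)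
  then show ?case
    by (cases "p = 0") (simp_all add: reflect_poly_pCons' ieval_pCons field_simps)
qed simp

text \<open>The minimal polynomial over \<rat>, scaled to be primitive instead of monic: the primes
  dividing its constant or leading coefficient then show at which finite places \<open>z\<close> or
  \<open>inverse z\<close> is small. Content 1 also rules out \<open>f = 0\<close>.\<close>

definition minimal_int_poly :: "int poly \<Rightarrow> 'a :: field_char_0 \<Rightarrow> bool" where
  "minimal_int_poly f z \<longleftrightarrow> content f = 1 \<and> ieval f z = 0 \<and>
     (\<forall>g. g \<noteq> 0 \<longrightarrow> ieval g z = 0 \<longrightarrow> degree f \<le> degree g)"

lemma minimal_int_polyD:
  assumes "minimal_int_poly f z"
  shows "content f = 1" "f \<noteq> 0" "ieval f z = 0"
    and "\<And>g. ieval g z = 0 \<Longrightarrow> degree g < degree f \<Longrightarrow> g = 0"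
  using assms by (auto simp: minimal_int_poly_def not_less)

lemma minimal_int_poly_exists:
  assumes "algebraic z"
  obtains f where "minimal_int_poly f z"
proof -
  obtain p where p: "p \<noteq> 0" "ieval p z = 0"
    using assms by (elim algebraicE') (auto simp: ieval_def)
  define g where "g = (ARG_MIN degree g. g \<noteq> 0 \<and> ieval g z = 0)"
  have g: "g \<noteq> 0" "ieval g z = 0" "\<And>h. h \<noteq> 0 \<Longrightarrow> ieval h z = 0 \<Longrightarrow> degree g \<le> degree h"
    using arg_min_natI[of "\<lambda>g. g \<noteq> 0 \<and> ieval g z = 0" p degree]
      arg_min_nat_le[of "\<lambda>g. g \<noteq> 0 \<and> ieval g z = 0" _ degree] p
    unfolding g_def by blast+
  have "ieval (smult (content g) (primitive_part g)) z = 0"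
    using g by simp
  then have "ieval (primitive_part g) z = 0"
    using g(1) by (simp del: content_times_primitive_part)
  then have "minimal_int_poly (primitive_part g) z"
    using g by (simp add: minimal_int_poly_def)
  then show ?thesis by (rule that)
qed

text \<open>Gauss's lemma. Pseudo-division leaves no remainder, by minimality of the degree, so
  \<open>smult a g = f * h\<close> with \<open>a\<close> nonzero; as \<open>f\<close> is primitive,
  \<open>a\<close> divides the content of \<open>h\<close> and cancels.\<close>

lemma minimal_int_poly_dvd:
  assumes f: "minimal_int_poly f z" and g: "ieval g z = 0"
  shows "f dvd g"
proof -
  note f' = minimal_int_polyD[OF f]
  obtain a h where a: "a \<noteq> 0" and ah: "smult a g = f * h + pseudo_mod g f"
    using pseudo_mod(1)[OF f'(2)] by blast
  have "ieval (pseudo_mod g f) z = 0"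
    using arg_cong[OF ah, of "\<lambda>x. ieval x z"] f' g by simp
  then have "pseudo_mod g f = 0"
    using f'(4) pseudo_mod(2)[OF f'(2), of g] by blast
  then have eq: "smult a g = f * h" using ah by simp
  have "content (smult a g) = content h"
    unfolding eq using f'(1) by (simp add: content_mult)
  then have "normalize a dvd content h"
    by (metis content_smult dvd_triv_left)
  then have "a dvd content h" by simp
  then have "[:a:] dvd h" by (simp add: const_poly_dvd_iff_dvd_content)
  then obtain h' where "h = smult a h'" by (auto elim!: dvdE)
  then have "g = f * h'" using eq a by (simp add: smult_cancel)
  then show ?thesis by simp
qed

lemma minimal_int_poly_degree_pos:
  assumes "minimal_int_poly f z" shows "degree f > 0"
proof (rule ccontr)
  assume "\<not> degree f > 0"
  then obtain a where "f = [:a:]" by (auto elim: degree_eq_zeroE)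
  then show False using minimal_int_polyD[OF assms] by simp
qed

lemma minimal_int_poly_coeff_0:
  assumes f: "minimal_int_poly f z" and "z \<noteq> 0" shows "coeff f 0 \<noteq> 0"
proof
  assume "coeff f 0 = 0"
  then obtain g where g: "f = pCons 0 g" by (cases f) auto
  then have "ieval g z = 0" "g \<noteq> 0" "degree g < degree f"
    using minimal_int_polyD[OF f] assms(2) by (auto simp: ieval_pCons)
  then show False using minimal_int_polyD(4)[OF f] by blast
qed

text \<open>Integer polynomials do not form a principal ideal domain, so a nonzero integer takes the
  place of 1. An element \<open>g\<close> of least degree in the ideal of \<open>f\<close> and
  \<open>p\<close> divides nonzero integer multiples of both. It cannot vanish at \<open>z\<close>,
  so its cofactor in the multiple of \<open>f\<close> does; that cofactor has full degree, and
  \<open>g\<close> is constant.\<close>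

lemma minimal_int_poly_bezout:
  assumes f: "minimal_int_poly f z" and p: "ieval p z \<noteq> 0"
  obtains u v m where "m \<noteq> 0" "u * f + v * p = [:m:]"
proof -
  note f' = minimal_int_polyD[OF f]
  define I where "I = (\<lambda>g. \<exists>u v. g = u * f + v * p)"
  have I_f: "I f" unfolding I_def by (rule exI[of _ 1], rule exI[of _ 0]) simp
  have I_p: "I p" unfolding I_def by (rule exI[of _ 0], rule exI[of _ 1]) simp
  have I_diff: "I (smult a g - h * g')" if "I g" "I g'" for a g g' h
  proof -
    obtain u v u' v' where "g = u * f + v * p" "g' = u' * f + v' * p"
      using \<open>I g\<close> \<open>I g'\<close> by (auto simp: I_def)
    then have "smult a g - h * g' = (smult a u - h * u') * f + (smult a v - h * v') * p"
      by (simp add: algebra_simps smult_add_right)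
    then show ?thesis unfolding I_def by blast
  qed
  define g where "g = (ARG_MIN degree g. g \<noteq> 0 \<and> I g)"
  have g: "g \<noteq> 0" "I g" "\<And>h. h \<noteq> 0 \<Longrightarrow> I h \<Longrightarrow> degree g \<le> degree h"
    using arg_min_natI[of "\<lambda>g. g \<noteq> 0 \<and> I g" f degree]
      arg_min_nat_le[of "\<lambda>g. g \<noteq> 0 \<and> I g" _ degree] f'(2) I_f
    unfolding g_def by blast+
  have div: "\<exists>a q. a \<noteq> 0 \<and> smult a h = g * q" if "I h" for h
  proof -
    obtain a q where aq: "a \<noteq> 0" "smult a h = g * q + pseudo_mod h g"
      using pseudo_mod(1)[OF g(1)] by blast
    then have "pseudo_mod h g = smult a h - q * g" by (simp add: algebra_simps)
    then have "I (pseudo_mod h g)" using I_diff[OF \<open>I h\<close> g(2)] by simp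
    then have "pseudo_mod h g = 0"
      using pseudo_mod(2)[OF g(1), of h] g(3) by (meson not_less)
    then show ?thesis using aq by auto
  qed
  obtain a q where aq: "a \<noteq> 0" "smult a f = g * q" using div[OF I_f] by blast
  obtain b r where br: "b \<noteq> 0" "smult b p = g * r" using div[OF I_p] by blast
  have "of_int b * ieval p z = ieval g z * ieval r z"
    using arg_cong[OF br(2), of "\<lambda>x. ieval x z"] by simp
  then have "ieval g z \<noteq> 0" using br p by auto
  moreover have "of_int a * ieval f z = ieval g z * ieval q z"
    using arg_cong[OF aq(2), of "\<lambda>x. ieval x z"] by simp
  ultimately have "ieval q z = 0" using f'(3) by simp
  moreover have "q \<noteq> 0" using aq f'(2) by auto
  moreover have "degree f = degree g + degree q"
    using arg_cong[OF aq(2), of degree] aq(1) g(1) \<open>q \<noteq> 0\<close> by (simp add: degree_mult_eq)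
  ultimately have "degree g = 0" using f'(4)[of q] by (cases "degree g") auto
  then obtain m where m: "g = [:m:]" by (auto elim: degree_eq_zeroE)
  then show ?thesis using that[of m] g(1,2) by (auto simp: I_def)
qed

text \<open>If \<open>p\<close> vanished at \<open>w\<close> but not at \<open>z\<close>, a Bezout
  relation evaluated at \<open>w\<close> would give \<open>m = 0\<close>. This transports vanishing
  sums from \<open>z\<close> to its conjugates.\<close>

lemma minimal_int_poly_conjugate:
  assumes f: "minimal_int_poly f z" and w: "ieval f w = 0"
  shows "ieval p w = 0 \<longleftrightarrow> ieval p z = 0"
proof
  assume "ieval p z = 0"
  then obtain h where "p = f * h" using minimal_int_poly_dvd[OF f] by blast
  then show "ieval p w = 0" using w by simp
next
  assume pw: "ieval p w = 0"
  show "ieval p z = 0"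
  proof (rule ccontr)
    assume "ieval p z \<noteq> 0"
    then obtain u v m where m: "m \<noteq> 0" and eq: "u * f + v * p = [:m:]"
      using minimal_int_poly_bezout[OF f] by blast
    show False
      using arg_cong[OF eq, of "\<lambda>x. ieval x w"] m pw w by simp
  qed
qed

text \<open>At a double root the derivative would vanish, hence also at the conjugate
  \<open>z\<close>, despite its smaller degree. Over the complex numbers this makes the number of
  roots equal to the degree.\<close>

lemma minimal_int_poly_rsquarefree:
  fixes z :: "'a :: field_char_0"
  assumes f: "minimal_int_poly f z"
  shows "rsquarefree (map_poly of_int f :: 'a poly)"
  unfolding rsquarefree_roots
proof (intro allI notI)
  fix w :: 'a
  assume w: "poly (map_poly of_int f) w = 0 \<and> poly (pderiv (map_poly of_int f)) w = 0"
  have "pderiv (map_poly of_int f :: 'a poly) = map_poly of_int (pderiv f)"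
    by (intro poly_eqI) (simp add: coeff_pderiv coeff_map_poly)
  then have "ieval (pderiv f) w = 0" "ieval f w = 0"
    using w by (simp_all add: ieval_def)
  then have "ieval (pderiv f) z = 0"
    using minimal_int_poly_conjugate[OF f] by blast
  moreover have "degree (pderiv f) < degree f"
    using minimal_int_poly_degree_pos[OF f] by (simp add: degree_pderiv)
  ultimately have "pderiv f = 0" using minimal_int_polyD(4)[OF f] by blast
  then show False
    using minimal_int_poly_degree_pos[OF f] by (simp add: pderiv_eq_0_iff)
qed

text \<open>Reflection exchanges the constant and the leading coefficient and inverts the roots, so
  that results about \<open>z\<close> can be applied to \<open>inverse z\<close>. The degree is
  preserved because the constant coefficient is nonzero.\<close>

lemma minimal_int_poly_reflect:
  assumes f: "minimal_int_poly f z" and z: "z \<noteq> 0"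
  shows "minimal_int_poly (reflect_poly f) (inverse z)"
  unfolding minimal_int_poly_def
proof (intro conjI allI impI)
  note f' = minimal_int_polyD[OF f]
  note f0 = minimal_int_poly_coeff_0[OF f z]
  have "content (reflect_poly f) dvd coeff f n" for n
  proof (cases "n \<le> degree f")
    case True
    then have "coeff f n = coeff (reflect_poly f) (degree f - n)"
      by (simp add: coeff_reflect_poly)
    then show ?thesis by (metis content_dvd_coeff)
  qed (simp add: coeff_eq_0)
  then have "[:content (reflect_poly f):] dvd f" by (simp add: const_poly_dvd_iff)
  then show "content (reflect_poly f) = 1"
    using f'(1) by (metis const_poly_dvd_iff_dvd_content is_unit_content_iff)
  show "ieval (reflect_poly f) (inverse z) = 0"
    using f' z by (simp add: ieval_reflect_poly)
  fix g :: "int poly"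
  assume g: "g \<noteq> 0" "ieval g (inverse z) = 0"
  then have "ieval (reflect_poly g) z = 0" using z by (simp add: ieval_reflect_poly)
  then have "degree f \<le> degree (reflect_poly g)"
    using f'(4)[of "reflect_poly g"] g by (force simp: not_less)
  then show "degree (reflect_poly f) \<le> degree g"
    using f0 degree_reflect_poly_le[of g] by simp
qed

section \<open>The gap property of algebraic numbers\<close>

text \<open>
  A sum of boundedly many terms with high powers of \<open>z\<close> cannot cancel a fixed nonzero
  element; this is how smallness of \<open>z\<close> at some place is used.
\<close>

definition gap :: "'a :: field_char_0 \<Rightarrow> bool" where
  "gap z \<longleftrightarrow> (\<forall>c (J :: nat set) q. finite J \<longrightarrow> ieval c z \<noteq> 0 \<longrightarrow>
     (\<exists>G. \<forall>y. (\<forall>j\<in>J. G \<le> y j) \<longrightarrow> ieval c z + (\<Sum>j\<in>J. ieval (q j) z * z ^ y j) \<noteq> 0))"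

text \<open>
  If \<open>f * w = p ^ e * m\<close> holds modulo the \<open>G\<close>-th power of the variable, then \<open>p\<close> divides all
  but the last few coefficients of \<open>w\<close>; cancelling \<open>p\<close> lowers \<open>e\<close> by one at the cost of at most
  \<open>t\<close> coefficients, and for \<open>e = 0\<close> the constant coefficients contradict each other unless
  \<open>G = 0\<close>.
\<close>

lemma truncated_inverse_bound:
  fixes f w :: "nat \<Rightarrow> int"
  assumes p: "prime p" and f0: "p dvd f 0" and t: "\<not> p dvd f t" and m: "\<not> p dvd m"
    and eq: "\<And>i. i < G \<Longrightarrow> (\<Sum>l\<le>i. f l * w (i - l)) = (if i = 0 then p ^ e * m else 0)"
  shows "G \<le> e * t"
  using eq
proof (induction e arbitrary: G w)
  case 0
  show ?case
  proof (rule ccontr)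
    assume "\<not> G \<le> 0 * t"
    then have "f 0 * w 0 = m" using 0[of 0] by simp
    then show False using f0 m by auto
  qed
next
  case (Suc e)
  \<comment> \<open>The first index at which \<open>p\<close> stops dividing \<open>f\<close>. It is
    at most \<open>t\<close>, so losing \<open>s\<close> coefficients per cancellation costs at most
    \<open>t\<close>.\<close>
  define s where "s = (LEAST s. \<not> p dvd f s)"
  have s: "\<not> p dvd f s" "s \<le> t" "\<And>l. l < s \<Longrightarrow> p dvd f l"
    unfolding s_def
    by (rule LeastI[of "\<lambda>s. \<not> p dvd f s", OF t], rule Least_le[of "\<lambda>s. \<not> p dvd f s", OF t],
        drule not_less_Least[of _ "\<lambda>s. \<not> p dvd f s"], simp)
  \<comment> \<open>Compare coefficients at \<open>i + s\<close>. Apart from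
    \<open>f s * w i\<close> every term is divisible by \<open>p\<close>: for \<open>l < s\<close>
    through \<open>f l\<close>, for \<open>l > s\<close> through \<open>w (i + s - l)\<close> by
    induction.\<close>
  have w_dvd: "p dvd w i" if "i + s < G" for i
    using that
  proof (induction i rule: less_induct)
    case (less i)
    have "p dvd (\<Sum>l\<le>i + s. f l * w (i + s - l))"
      using Suc.prems[OF less.prems] by simp
    also have "(\<Sum>l\<le>i + s. f l * w (i + s - l)) =
        f s * w i + (\<Sum>l\<in>{..i + s} - {s}. f l * w (i + s - l))"
      by (subst sum.remove[of _ s]) auto
    finally have *: "p dvd f s * w i + (\<Sum>l\<in>{..i + s} - {s}. f l * w (i + s - l))" .
    have "p dvd (\<Sum>l\<in>{..i + s} - {s}. f l * w (i + s - l))"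
    proof (rule dvd_sum)
      fix l assume "l \<in> {..i + s} - {s}"
      then have l: "l \<le> i + s" "l \<noteq> s" by auto
      show "p dvd f l * w (i + s - l)"
      proof (cases "l < s")
        case False
        then have "p dvd w (i + s - l)" using l less by (intro less.IH) auto
        then show ?thesis by simp
      qed (simp add: s(3))
    qed
    then have "p dvd f s * w i" using * by (simp add: dvd_add_left_iff)
    then show "p dvd w i" using s(1) p by (simp add: prime_dvd_mult_iff)
  qed
  \<comment> \<open>The quotients \<open>w i div p\<close> satisfy the hypothesis for
    \<open>e\<close>, with \<open>s\<close> fewer coefficients available.\<close>
  have "G - s \<le> e * t"
  proof (rule Suc.IH[of "G - s" "\<lambda>i. w i div p"])
    fix i assume i: "i < G - s"
    have "p * (\<Sum>l\<le>i. f l * (w (i - l) div p)) = (\<Sum>l\<le>i. f l * w (i - l))"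
      unfolding sum_distrib_left
    proof (rule sum.cong)
      fix l assume "l \<in> {..i}"
      then have "p dvd w (i - l)" using i by (intro w_dvd) auto
      then show "p * (f l * (w (i - l) div p)) = f l * w (i - l)"
        by (simp add: mult.left_commute)
    qed simp
    also have "\<dots> = p * (if i = 0 then p ^ e * m else 0)"
      using i by (subst Suc.prems) auto
    finally show "(\<Sum>l\<le>i. f l * (w (i - l) div p)) = (if i = 0 then p ^ e * m else 0)"
      using p by auto
  qed
  then show ?case using s(2) by simp
qed

text \<open>A prime divisor of the constant coefficient stands for a finite place at which
  \<open>z\<close> is small. Instead of constructing a valuation, a cancellation is turned into an
  inverse of \<open>f\<close>, up to an integer factor, modulo a power of the variable, and
  \<open>truncated_inverse_bound\<close> limits that power.\<close>

lemma gap_if_constant_coeff_not_unit: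
  assumes f: "minimal_int_poly f z" and f0: "\<not> is_unit (coeff f 0)" and z: "z \<noteq> 0"
  shows "gap z"
  unfolding gap_def
proof (intro allI impI)
  fix c :: "int poly" and J :: "nat set" and q :: "nat \<Rightarrow> int poly"
  assume J: "finite J" and c: "ieval c z \<noteq> 0"
  note f' = minimal_int_polyD[OF f]
  obtain p where p: "prime p" "p dvd coeff f 0"
    using prime_divisor_exists[OF minimal_int_poly_coeff_0[OF f z] f0] by blast
  \<comment> \<open>Since \<open>f\<close> is primitive, \<open>p\<close> does not divide all its
    coefficients.\<close>
  obtain t where t: "\<not> p dvd coeff f t"
    using p(1) f'(1) const_poly_dvd_iff[of p f] const_poly_dvd_iff_dvd_content[of p f] by auto
  obtain u v m where m: "m \<noteq> 0" and uv: "u * f + v * c = [:m:]"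
    using minimal_int_poly_bezout[OF f c] by blast
  define e where "e = multiplicity p m"
  obtain m' where m': "m = p ^ e * m'" "\<not> p dvd m'"
    using multiplicity_decompose'[of m p] m p(1) unfolding e_def by (metis not_prime_unit)
  have "ieval c z + (\<Sum>j\<in>J. ieval (q j) z * z ^ y j) \<noteq> 0" if y: "\<forall>j\<in>J. Suc (e * t) \<le> y j" for y
  proof
    \<comment> \<open>The least value exceeding the bound of
      \<open>truncated_inverse_bound\<close>.\<close>
    define G where "G = Suc (e * t)"
    define h where "h = (\<Sum>j\<in>J. q j * monom 1 (y j - G))"
    have h: "monom 1 G * h = (\<Sum>j\<in>J. q j * monom 1 (y j))"
      unfolding h_def sum_distrib_left using y
      by (intro sum.cong) (auto simp: mult.left_commute mult_monom G_def)
    assume "ieval c z + (\<Sum>j\<in>J. ieval (q j) z * z ^ y j) = 0"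
    then have "ieval (c + monom 1 G * h) z = 0"
      unfolding h by simp
    then obtain k where k: "c + monom 1 G * h = f * k"
      using minimal_int_poly_dvd[OF f] by blast
    \<comment> \<open>Replacing \<open>f * k\<close> by \<open>c + monom 1 G * h\<close> completes
      \<open>u * f + v * c\<close>, which is the constant \<open>m\<close>.\<close>
    have "f * (u + v * k) = u * f + v * (f * k)" by (simp add: algebra_simps)
    also have "\<dots> = [:m:] + monom 1 G * (v * h)"
      unfolding k[symmetric] uv[symmetric] by (simp add: algebra_simps)
    finally have eq: "f * (u + v * k) = [:m:] + monom 1 G * (v * h)" .
    have "(\<Sum>l\<le>i. coeff f l * coeff (u + v * k) (i - l)) = (if i = 0 then p ^ e * m' else 0)"
      if "i < G" for i
      using arg_cong[OF eq, of "\<lambda>x. coeff x i"] that m'(1)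
      by (auto simp: coeff_mult coeff_monom_mult coeff_pCons split: nat.splits)
    then have "G \<le> e * t"
      by (rule truncated_inverse_bound[OF p t m'(2)])
    then show False by (simp add: G_def)
  qed
  then show "\<exists>G. \<forall>y. (\<forall>j\<in>J. G \<le> y j) \<longrightarrow>
      ieval c z + (\<Sum>j\<in>J. ieval (q j) z * z ^ y j) \<noteq> 0" by (intro exI allI impI)
qed

text \<open>The sum is transported to the conjugate \<open>w\<close>, where high powers are too
  small to cancel the fixed nonzero value of \<open>c\<close>.\<close>

lemma gap_if_small_conjugate:
  fixes z w :: complex
  assumes f: "minimal_int_poly f z" and w: "ieval f w = 0" "norm w < 1"
  shows "gap z"
  unfolding gap_def
proof (intro allI impI)
  fix c :: "int poly" and J :: "nat set" and q :: "nat \<Rightarrow> int poly"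
  assume J: "finite J" and c: "ieval c z \<noteq> 0"
  define B where "B = (\<Sum>j\<in>J. norm (ieval (q j) w))"
  have cw: "norm (ieval c w) > 0"
    using c minimal_int_poly_conjugate[OF f w(1)] by simp
  have B: "B \<ge> 0" unfolding B_def by (rule sum_nonneg) simp
  \<comment> \<open>\<open>B\<close> may be zero, hence the denominator
    \<open>B + 1\<close>.\<close>
  obtain G where "norm w ^ G < norm (ieval c w) / (B + 1)"
    using real_arch_pow_inv[OF _ w(2), of "norm (ieval c w) / (B + 1)"] cw B by auto
  then have G: "(B + 1) * norm w ^ G < norm (ieval c w)"
    using B by (simp add: field_simps)
  have "ieval c z + (\<Sum>j\<in>J. ieval (q j) z * z ^ y j) \<noteq> 0" if y: "\<forall>j\<in>J. G \<le> y j" for y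
  proof
    assume "ieval c z + (\<Sum>j\<in>J. ieval (q j) z * z ^ y j) = 0"
    then have "ieval (c + (\<Sum>j\<in>J. q j * monom 1 (y j))) z = 0" by simp
    then have "ieval (c + (\<Sum>j\<in>J. q j * monom 1 (y j))) w = 0"
      using minimal_int_poly_conjugate[OF f w(1)] by blast
    then have "ieval c w = - (\<Sum>j\<in>J. ieval (q j) w * w ^ y j)"
      by (simp add: eq_neg_iff_add_eq_0)
    then have "norm (ieval c w) \<le> (\<Sum>j\<in>J. norm (ieval (q j) w * w ^ y j))"
      by (simp add: norm_sum)
    also have "\<dots> \<le> (\<Sum>j\<in>J. norm (ieval (q j) w) * norm w ^ G)"
      using w(2) y by (intro sum_mono) (auto simp: norm_mult norm_power intro!: mult_left_mono power_decreasing)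
    also have "\<dots> = B * norm w ^ G" by (simp add: B_def sum_distrib_right)
    also have "\<dots> \<le> (B + 1) * norm w ^ G" by (intro mult_right_mono) auto
    finally show False using G by simp
  qed
  then show "\<exists>G. \<forall>y. (\<forall>j\<in>J. G \<le> y j) \<longrightarrow>
      ieval c z + (\<Sum>j\<in>J. ieval (q j) z * z ^ y j) \<noteq> 0" by (intro exI allI impI)
qed

section \<open>Kronecker's theorem on roots of unity\<close>

lemma finite_int_polys_bounded_on:
  fixes A :: "complex set"
  assumes A: "finite A"
  shows "finite {r :: int poly. degree r < card A \<and> (\<forall>w\<in>A. norm (ieval r w) \<le> 1)}"
    (is "finite ?R")
proof -
  \<comment> \<open>Lagrange interpolation at the points of \<open>A\<close> bounds the coefficients.\<close>
  define L where "L = (\<lambda>w. smult (inverse (\<Prod>v\<in>A - {w}. w - v)) (\<Prod>v\<in>A - {w}. [:- v, 1:]))"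
  have L_w: "poly (L w) w = 1" if "w \<in> A" for w
    using A that by (auto simp: L_def poly_prod)
  have L_v: "poly (L w) v = 0" if "v \<in> A" "v \<noteq> w" for v w
    using A that by (auto simp: L_def poly_prod)
  have deg_L: "degree (L w) < card A" if "w \<in> A" for w
  proof -
    have "degree (L w) \<le> card (A - {w})"
      unfolding L_def using degree_prod_sum_le[of "A - {w}" "\<lambda>v. [:- v, 1:]"] A
      by (auto intro: order.trans[OF degree_smult_le])
    also have "\<dots> < card A" using A that by (rule card_Diff1_less)
    finally show ?thesis .
  qed
  \<comment> \<open>The values of \<open>r\<close> on \<open>A\<close> have modulus at most 1, so
    this sum of the moduli of all coefficients of the Lagrange basis bounds every coefficient of
    \<open>r\<close>.\<close>
  define C where "C = (\<Sum>w\<in>A. \<Sum>i<card A. norm (coeff (L w) i))"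
  have bound: "\<bar>coeff r i\<bar> \<le> \<lceil>C\<rceil>" if "r \<in> ?R" for r i
  proof (cases "i < card A")
    case True
    \<comment> \<open>Both sides have degree below \<open>card A\<close> and agree on
      \<open>A\<close>.\<close>
    have eq: "map_poly of_int r = (\<Sum>w\<in>A. smult (ieval r w) (L w))"
    proof (rule poly_eqI_degree)
      fix v assume v: "v \<in> A"
      have "poly (\<Sum>w\<in>A. smult (ieval r w) (L w)) v = (\<Sum>w\<in>A. ieval r w * poly (L w) v)"
        by (simp add: poly_sum)
      also have "\<dots> = (\<Sum>w\<in>A. if w = v then ieval r v else 0)"
        using v L_w L_v by (intro sum.cong) auto
      finally show "poly (map_poly of_int r) v = poly (\<Sum>w\<in>A. smult (ieval r w) (L w)) v"
        using v A by (simp add: ieval_def)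
    next
      show "degree (map_poly of_int r :: complex poly) < card A"
        using that map_poly_degree_leq[of of_int r] by (auto intro: le_less_trans)
      show "degree (\<Sum>w\<in>A. smult (ieval r w) (L w)) < card A"
        using True deg_L by (intro degree_sum_less) (auto intro: le_less_trans[OF degree_smult_le])
    qed
    have "of_int \<bar>coeff r i\<bar> = norm (coeff (map_poly of_int r :: complex poly) i)"
      by (simp add: coeff_map_poly)
    also have "\<dots> \<le> (\<Sum>w\<in>A. norm (ieval r w * coeff (L w) i))"
      unfolding eq by (simp add: coeff_sum norm_sum)
    also have "\<dots> \<le> (\<Sum>w\<in>A. norm (coeff (L w) i))"
      using that by (intro sum_mono) (auto simp: norm_mult intro: mult_left_le_one_le)
    also have "\<dots> \<le> C"
      unfolding C_def using True by (intro sum_mono member_le_sum) auto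
    finally show ?thesis by linarith
  next
    case False
    have "C \<ge> 0" unfolding C_def by (intro sum_nonneg) simp
    then show ?thesis using False that by (simp add: coeff_eq_0)
  qed
  have "?R \<subseteq> Poly ` {xs. set xs \<subseteq> {-\<lceil>C\<rceil>..\<lceil>C\<rceil>} \<and> length xs \<le> card A}"
  proof
    fix r assume r: "r \<in> ?R"
    have "set (coeffs r) \<subseteq> {-\<lceil>C\<rceil>..\<lceil>C\<rceil>}"
    proof
      fix x assume "x \<in> set (coeffs r)"
      then obtain i where "x = coeff r i"
        using range_coeff[of r] by (metis imageE insertI2)
      then show "x \<in> {-\<lceil>C\<rceil>..\<lceil>C\<rceil>}" using bound[OF r, of i] by auto
    qed
    moreover have "length (coeffs r) \<le> card A"
      using r by (cases "r = 0") (auto simp: length_coeffs_degree)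
    ultimately show "r \<in> Poly ` {xs. set xs \<subseteq> {-\<lceil>C\<rceil>..\<lceil>C\<rceil>} \<and> length xs \<le> card A}"
      by (intro image_eqI[of _ _ "coeffs r"]) auto
  qed
  then show ?thesis
    by (rule finite_subset) (intro finite_imageI finite_lists_length_le, simp)
qed

text \<open>A unit leading coefficient keeps the remainders of powers modulo \<open>f\<close>
  integral, and their values at all roots of \<open>f\<close> have modulus at most 1. Only finitely
  many such remainders exist, so two powers of \<open>z\<close> agree up to sign.\<close>

lemma kronecker_root_of_unity:
  fixes z :: complex
  assumes f: "minimal_int_poly f z" and lc: "is_unit (lead_coeff f)" and z: "z \<noteq> 0"
    and roots: "\<And>w :: complex. ieval f w = 0 \<Longrightarrow> norm w \<le> 1"
  shows "\<exists>n>0. z ^ n = 1"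
proof -
  note f' = minimal_int_polyD[OF f]
  define A where "A = {w :: complex. ieval f w = 0}"
  have f_complex: "map_poly of_int f \<noteq> (0 :: complex poly)"
    using f'(2) by (metis minimal_int_poly_rsquarefree[OF f] rsquarefree_def)
  have A: "finite A"
    unfolding A_def ieval_def using f_complex by (rule poly_roots_finite)
  \<comment> \<open>As \<open>f\<close> has no repeated roots, \<open>card A\<close> equals its
    degree, and remainders modulo \<open>f\<close> meet the degree bound of
    \<open>finite_int_polys_bounded_on\<close>.\<close>
  have "map_poly of_int f = smult (lead_coeff (map_poly of_int f)) (\<Prod>w\<in>A. [:- w, 1:])"
    using complex_poly_decompose_rsquarefree[OF minimal_int_poly_rsquarefree[OF f]]
    by (simp add: A_def ieval_def)
  then have "degree (map_poly of_int f :: complex poly) = degree (\<Prod>w\<in>A. [:- w, 1:])"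
    using f_complex by (metis degree_smult_eq leading_coeff_0_iff)
  also have "\<dots> = card A" by (simp add: degree_prod_sum_eq)
  finally have card_A: "card A = degree f" by (simp add: degree_map_poly)
  \<comment> \<open>\<open>r\<close> is the remainder of the \<open>n\<close>-th power of the variable modulo \<open>f\<close>, with the sign \<open>\<sigma>\<close>
    coming from the leading coefficient \<open>\<plusminus>1\<close>. By pigeonhole two such remainders coincide.\<close>
  have "\<exists>r \<sigma>. degree r < degree f \<and> \<sigma> ^ 2 = 1 \<and> (\<forall>w\<in>A. ieval r w = of_int \<sigma> * w ^ n)" for n
  proof -
    obtain q r where qr: "pseudo_divmod (monom 1 n) f = (q, r)" by (cases "pseudo_divmod (monom 1 n) f")
    define \<sigma> where "\<sigma> = lead_coeff f ^ (Suc (degree (monom 1 n :: int poly)) - degree f)"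
    have eq: "smult \<sigma> (monom 1 n) = f * q + r" and deg: "r = 0 \<or> degree r < degree f"
      using pseudo_divmod[OF f'(2) qr] by (simp_all add: \<sigma>_def)
    have "degree r < degree f"
      using deg minimal_int_poly_degree_pos[OF f] by auto
    moreover have "lead_coeff f = 1 \<or> lead_coeff f = - 1" using lc by (auto simp: abs_if split: if_splits)
    then have "(lead_coeff f)\<^sup>2 = 1" by auto
    then have "\<sigma> ^ 2 = 1" by (simp add: \<sigma>_def flip: power_mult) (simp add: mult.commute power_mult)
    moreover have "ieval r w = of_int \<sigma> * w ^ n" if "w \<in> A" for w
      using arg_cong[OF eq, of "\<lambda>x. ieval x w"] that by (simp add: A_def)
    ultimately show ?thesis by blast
  qed
  then obtain r \<sigma> where r: "\<And>n. degree (r n) < degree f" "\<And>n. \<sigma> n ^ 2 = (1 :: int)"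
      "\<And>n w. w \<in> A \<Longrightarrow> ieval (r n) w = of_int (\<sigma> n) * w ^ n"
    by metis
  have norm_\<sigma>: "norm (of_int (\<sigma> n) :: complex) = 1" for n
    using r(2)[of n] by (auto simp: power2_eq_1_iff)
  have "norm (ieval (r n) w) \<le> 1" if "w \<in> A" for n w
    using that roots[of w] norm_\<sigma>[of n]
    by (simp add: r(3) A_def norm_mult norm_power power_le_one del: norm_of_int)
  then have "range r \<subseteq> {r. degree r < card A \<and> (\<forall>w\<in>A. norm (ieval r w) \<le> 1)}"
    using r(1) card_A by auto
  then have "finite (range r)"
    using finite_int_polys_bounded_on[OF A] by (rule finite_subset)
  then obtain i j where ij: "i < j" "r i = r j"
    by (metis finite_imageD infinite_UNIV_nat inj_on_def linorder_neqE_nat)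
  have "z \<in> A" using f' by (simp add: A_def)
  then have "of_int (\<sigma> i) * z ^ i = of_int (\<sigma> j) * z ^ j"
    using ij r(3) by metis
  \<comment> \<open>Squaring removes the signs; it is the source of the factor 2 in the
    exponent.\<close>
  then have "(of_int (\<sigma> i) * z ^ i)\<^sup>2 = (of_int (\<sigma> j) * z ^ j)\<^sup>2" by simp
  moreover have "(of_int (\<sigma> n))\<^sup>2 = (1 :: complex)" for n
    using r(2)[of n] by (metis of_int_1 of_int_power)
  ultimately have "z ^ (i * 2) = z ^ (j * 2)"
    by (simp add: power_mult_distrib power_mult)
  also have "\<dots> = z ^ (i * 2) * z ^ ((j - i) * 2)"
    using ij(1) by (simp flip: power_add add: algebra_simps)
  finally have "z ^ ((j - i) * 2) = 1" using z by simp
  then show ?thesis using ij(1) by (intro exI[of _ "(j - i) * 2"]) auto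
qed

text \<open>A non-unit constant coefficient makes \<open>z\<close> small at a finite place; a
  non-unit leading coefficient or a conjugate outside the unit circle makes \<open>inverse z\<close>
  small at some place. If the leading coefficient is a unit and all conjugates lie in the closed
  disc, Kronecker's theorem applies.\<close>

lemma root_of_unity_or_gap:
  fixes z :: complex
  assumes z: "algebraic z" "z \<noteq> 0"
  shows "(\<exists>n>0. z ^ n = 1) \<or> gap z \<or> gap (inverse z)"
proof -
  obtain f where f: "minimal_int_poly f z"
    using minimal_int_poly_exists[OF z(1)] .
  note rf = minimal_int_poly_reflect[OF f z(2)]
  consider "\<not> is_unit (coeff f 0)" | "\<not> is_unit (lead_coeff f)"
    | w :: complex where "ieval f w = 0" "norm w > 1"
    | "is_unit (lead_coeff f)" "\<And>w :: complex. ieval f w = 0 \<Longrightarrow> norm w \<le> 1"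
    by (meson not_le)
  then show ?thesis
  proof cases
    case 1
    then show ?thesis using gap_if_constant_coeff_not_unit[OF f _ z(2)] by blast
  next
    case 2
    then show ?thesis using gap_if_constant_coeff_not_unit[OF rf] z(2) by simp
  next
    case 3
    then have "ieval (reflect_poly f) (inverse w) = 0" "norm (inverse w) < 1"
      using ieval_reflect_poly[of "inverse w" f]
      by (force simp: norm_inverse inverse_less_1_iff simp flip: inverse_eq_divide)+
    then show ?thesis using gap_if_small_conjugate[OF rf] by blast
  next
    case 4
    then show ?thesis using kronecker_root_of_unity[OF f _ z(2)] by blast
  qed
qed

section \<open>Vanishing subsums\<close>

text \<open>The ring \<open>\<int>[z, inverse z]\<close> for \<open>z \<noteq> 0\<close>.\<close>

definition laurent :: "'a :: field_char_0 \<Rightarrow> 'a set" where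
  "laurent z = {x. \<exists>n p. x * z ^ n = ieval p z}"

lemma laurent_common_power:
  assumes "finite J" "\<And>j. j \<in> J \<Longrightarrow> q j \<in> laurent z"
  shows "\<exists>N p. \<forall>j\<in>J. q j * z ^ N = ieval (p j) z"
proof -
  obtain n p where np: "\<And>j. j \<in> J \<Longrightarrow> q j * z ^ n j = ieval (p j) z"
    using assms(2) unfolding laurent_def by simp metis
  \<comment> \<open>Any common upper bound of the exponents \<open>n j\<close> would serve; the sum
    avoids treating empty \<open>J\<close> separately.\<close>
  define N where "N = (\<Sum>j\<in>J. n j)"
  have "q j * z ^ N = ieval (monom 1 (N - n j) * p j) z" if "j \<in> J" for j
  proof -
    have "n j \<le> N" unfolding N_def using assms(1) that by (intro member_le_sum) auto
    then have "z ^ N = z ^ (N - n j) * z ^ n j" by (simp flip: power_add)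
    then show ?thesis using np[OF that] by (simp add: algebra_simps)
  qed
  then show ?thesis by (intro exI ballI)
qed

lemma laurent_sum:
  assumes "finite J" "\<And>j. j \<in> J \<Longrightarrow> q j \<in> laurent z"
  shows "sum q J \<in> laurent z"
proof -
  obtain N p where "\<And>j. j \<in> J \<Longrightarrow> q j * z ^ N = ieval (p j) z"
    using laurent_common_power[of J q z, OF assms] by auto
  then have "sum q J * z ^ N = ieval (sum p J) z"
    by (simp add: sum_distrib_right)
  then show ?thesis unfolding laurent_def by blast
qed

lemma laurent_mult_power:
  assumes "x \<in> laurent z" "e \<ge> 0"
  shows "x * z powi e \<in> laurent z"
proof -
  obtain n p where "x * z ^ n = ieval p z"
    using assms(1) by (auto simp: laurent_def)
  then have "x * z powi e * z ^ n = ieval (monom 1 (nat e) * p) z"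
    using assms(2) by (simp add: power_int_def mult_ac)
  then show ?thesis unfolding laurent_def by blast
qed

lemma ieval_in_laurent: "ieval p z \<in> laurent z"
  unfolding laurent_def by (auto intro!: exI[of _ 0] exI[of _ p])

text \<open>The coefficients have to remain admissible when the gap property holds only for
  \<open>inverse z\<close>. Reflecting \<open>p\<close> expresses its value through powers of
  \<open>inverse z\<close>, up to a power of \<open>z\<close>.\<close>

lemma ieval_in_laurent_inverse:
  assumes "z \<noteq> 0" shows "ieval p z \<in> laurent (inverse z)"
proof -
  have "ieval p z * inverse z ^ degree p = ieval (reflect_poly p) (inverse z)"
    using assms ieval_reflect_poly[of "inverse z" p] by simp
  then show ?thesis unfolding laurent_def by blast
qed

text \<open>Multiplication by \<open>z ^ N * z ^ M\<close> clears all denominators; the additional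
  powers are absorbed into the polynomial coefficients, so the bound on the exponents carries over
  unchanged.\<close>

lemma gap_laurent:
  fixes q :: "nat \<Rightarrow> 'a :: field_char_0"
  assumes z: "gap z" "z \<noteq> 0" and J: "finite J" and q: "\<And>j. j \<in> J \<Longrightarrow> q j \<in> laurent z"
    and c: "c \<in> laurent z" "c \<noteq> 0"
  shows "\<exists>G :: int. \<forall>y. (\<forall>j\<in>J. G \<le> y j) \<longrightarrow> c + (\<Sum>j\<in>J. q j * z powi y j) \<noteq> 0"
proof -
  obtain N p where p: "\<And>j. j \<in> J \<Longrightarrow> q j * z ^ N = ieval (p j) z"
    using laurent_common_power[of J q z, OF J q] by auto
  obtain M d where d: "c * z ^ M = ieval d z"
    using c(1) by (auto simp: laurent_def)
  have d0: "ieval (monom 1 N * d) z \<noteq> 0" using d c(2) z(2) by (auto simp flip: d)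
  obtain G where G: "\<And>y. (\<forall>j\<in>J. G \<le> y j) \<Longrightarrow>
      ieval (monom 1 N * d) z + (\<Sum>j\<in>J. ieval (monom 1 M * p j) z * z ^ y j) \<noteq> 0"
    using z(1)[unfolded gap_def, rule_format, OF J d0, of "\<lambda>j. monom 1 M * p j"] by blast
  show ?thesis
  proof (intro exI[of _ "int G"] allI impI)
    fix y :: "nat \<Rightarrow> int" assume y: "\<forall>j\<in>J. int G \<le> y j"
    have eq: "ieval (monom 1 N * d) z + (\<Sum>j\<in>J. ieval (monom 1 M * p j) z * z ^ nat (y j)) =
        z ^ N * z ^ M * (c + (\<Sum>j\<in>J. q j * z powi y j))"
      unfolding distrib_left sum_distrib_left
    proof (intro arg_cong2[of _ _ _ _ "(+)"] sum.cong)
      fix j assume j: "j \<in> J"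
      have "z powi y j = z ^ nat (y j)" using y j by (force simp: power_int_def)
      then show "ieval (monom 1 M * p j) z * z ^ nat (y j) = z ^ N * z ^ M * (q j * z powi y j)"
        using p[OF j, symmetric] by simp
    qed (simp_all flip: d)
    show "c + (\<Sum>j\<in>J. q j * z powi y j) \<noteq> 0"
    proof
      assume "c + (\<Sum>j\<in>J. q j * z powi y j) = 0"
      then have "ieval (monom 1 N * d) z + (\<Sum>j\<in>J. ieval (monom 1 M * p j) z * z ^ nat (y j)) = 0"
        unfolding eq by simp
      moreover have "\<forall>j\<in>J. G \<le> nat (y j)" using y by fastforce
      ultimately show False using G[of "\<lambda>j. nat (y j)"] by argo
    qed
  qed
qed

lemma finite_uniform_bound:
  fixes Q :: "'a \<Rightarrow> int \<Rightarrow> bool"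
  assumes "finite P" "\<And>p. p \<in> P \<Longrightarrow> \<exists>G. Q p G" "\<And>p G H. Q p G \<Longrightarrow> G \<le> H \<Longrightarrow> Q p H"
  shows "\<exists>G. \<forall>p\<in>P. Q p G"
proof -
  obtain g where g: "\<And>p. p \<in> P \<Longrightarrow> Q p (g p)" using assms(2) by metis
  have "Q p (Max (g ` P))" if "p \<in> P" for p
    using g[OF that] by (rule assms(3)) (use assms(1) that in auto)
  then show ?thesis by (intro exI ballI)
qed

text \<open>At a large gap between exponents, the terms above could not cancel the sum below, which
  is nonzero by indecomposability. For a bound independent of \<open>x\<close>, the induction
  controls one more of the lowest exponents at each stage.\<close>

lemma indecomposable_zero_sum_spread:
  fixes q :: "nat \<Rightarrow> 'a :: field_char_0"
  assumes z: "gap z" "z \<noteq> 0" and J: "finite J" and q: "\<And>j. j \<in> J \<Longrightarrow> q j \<in> laurent z"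
  shows "\<exists>D :: int. \<forall>x. (\<Sum>j\<in>J. q j * z powi x j) = 0 \<longrightarrow>
    (\<forall>I. I \<subset> J \<longrightarrow> I \<noteq> {} \<longrightarrow> (\<Sum>j\<in>I. q j * z powi x j) \<noteq> 0) \<longrightarrow>
    (\<forall>i\<in>J. \<forall>j\<in>J. \<bar>x i - x j\<bar> \<le> D)"
proof -
  define sol where "sol = (\<lambda>x. (\<Sum>j\<in>J. q j * z powi x j) = 0 \<and>
    (\<forall>I. I \<subset> J \<longrightarrow> I \<noteq> {} \<longrightarrow> (\<Sum>j\<in>I. q j * z powi x j) \<noteq> 0))"
  define low where "low = (\<lambda>x D. {j\<in>J. x j - Min (x ` J) \<le> (D :: int)})"
  \<comment> \<open>Unless \<open>low x D = J\<close>, raising \<open>D\<close> to the gap bound for all possible sums over \<open>low x D\<close>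
    adds an index to it, because the sum over \<open>low x D\<close> does not vanish.\<close>
  have "\<exists>D\<ge>0. \<forall>x. sol x \<longrightarrow> J \<noteq> {} \<longrightarrow> min n (card J) \<le> card (low x D)" for n
  proof (induction n)
    case (Suc n)
    then obtain D where D: "D \<ge> 0"
      "\<And>x. sol x \<Longrightarrow> J \<noteq> {} \<Longrightarrow> min n (card J) \<le> card (low x D)" by blast
    \<comment> \<open>All possible lower clusters, with exponents measured from the smallest one.
      There are finitely many, so one gap bound suffices for all of them.\<close>
    define P where "P = (SIGMA I : Pow J. I \<rightarrow>\<^sub>E {0..D})"
    have "finite P" unfolding P_def using J by (auto intro!: finite_SigmaI finite_PiE intro: finite_subset)
    \<comment> \<open>The premise makes every \<open>G\<close> acceptable for a cluster with sum
      zero, where the gap property says nothing.\<close>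
    define Q where "Q = (\<lambda>I e G. (\<Sum>j\<in>I. q j * z powi e j) \<noteq> 0 \<longrightarrow>
        (\<forall>y. (\<forall>j\<in>J - I. (G :: int) \<le> y j) \<longrightarrow>
          (\<Sum>j\<in>I. q j * z powi (e j :: int)) + (\<Sum>j\<in>J - I. q j * z powi y j) \<noteq> 0))"
    have "\<exists>G. Q (fst p) (snd p) G" if "p \<in> P" for p
    proof -
      obtain I e where p: "p = (I, e)" "I \<subseteq> J" "e \<in> I \<rightarrow>\<^sub>E {0..D}"
        using \<open>p \<in> P\<close> by (auto simp: P_def)
      have I: "finite I" using p(2) J by (rule finite_subset)
      have L: "(\<Sum>j\<in>I. q j * z powi e j) \<in> laurent z"
        using p by (intro laurent_sum laurent_mult_power I q) auto
      have "\<exists>G. Q I e G"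
      proof (cases "(\<Sum>j\<in>I. q j * z powi e j) = 0")
        case False
        have "finite (J - I)" "\<And>j. j \<in> J - I \<Longrightarrow> q j \<in> laurent z" using J q by auto
        from gap_laurent[of z "J - I" q, OF z this L False] show ?thesis unfolding Q_def by blast
      qed (simp add: Q_def)
      then show ?thesis by (simp add: p(1))
    qed
    moreover have "Q I e H" if "Q I e G" "G \<le> H" for I e G H
      unfolding Q_def
    proof (intro impI allI)
      fix y assume "(\<Sum>j\<in>I. q j * z powi e j) \<noteq> 0" and y: "\<forall>j\<in>J - I. H \<le> y j"
      moreover have "\<forall>j\<in>J - I. G \<le> y j" using y \<open>G \<le> H\<close> by (meson order.trans)
      ultimately show "(\<Sum>j\<in>I. q j * z powi e j) + (\<Sum>j\<in>J - I. q j * z powi y j) \<noteq> 0"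
        using \<open>Q I e G\<close> unfolding Q_def by blast
    qed
    ultimately have "\<exists>G. \<forall>p\<in>P. Q (fst p) (snd p) G"
      using \<open>finite P\<close> by (intro finite_uniform_bound)
    then obtain G where G: "\<And>p. p \<in> P \<Longrightarrow> Q (fst p) (snd p) G" by blast
    define D' where "D' = max D G"
    have "min (Suc n) (card J) \<le> card (low x D')" if x: "sol x" and J0: "J \<noteq> {}" for x
    proof (cases "low x D = J")
      case True
      have "low x D \<subseteq> low x D'" "low x D' \<subseteq> J" by (auto simp: low_def D'_def)
      then have "low x D' = J" using True by blast
      then show ?thesis by simp
    next
      case False
      define I where "I = low x D"
      define m where "m = Min (x ` J)"
      have I: "I \<subset> J" using False by (auto simp: I_def low_def)
      have "m \<in> x ` J" unfolding m_def using J J0 by (intro Min_in) auto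
      then have I0: "I \<noteq> {}" using D(1) by (auto simp: I_def low_def m_def)
      have m_le: "m \<le> x j" if "j \<in> J" for j
        unfolding m_def using J that by auto
      \<comment> \<open>Measuring exponents from \<open>m\<close> only multiplies sums by a power of
        \<open>z\<close>, so it does not affect whether they vanish.\<close>
      have shift: "(\<Sum>j\<in>K. q j * z powi (x j - m)) = z powi (- m) * (\<Sum>j\<in>K. q j * z powi x j)" for K
        unfolding sum_distrib_left using z(2)
        by (intro sum.cong) (simp_all add: power_int_diff power_int_minus field_simps)
      define e where "e = restrict (\<lambda>j. x j - m) I"
      have "e \<in> I \<rightarrow>\<^sub>E {0..D}"
        using m_le I by (auto simp: e_def I_def low_def m_def)
      then have "(I, e) \<in> P" using I by (auto simp: P_def)
      moreover have sum_e: "(\<Sum>j\<in>I. q j * z powi e j) = (\<Sum>j\<in>I. q j * z powi (x j - m))"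
        by (intro sum.cong) (auto simp: e_def)
      moreover have "(\<Sum>j\<in>I. q j * z powi e j) \<noteq> 0"
        unfolding sum_e shift using x I I0 z(2) by (auto simp: sol_def)
      moreover have "(\<Sum>j\<in>I. q j * z powi e j) + (\<Sum>j\<in>J - I. q j * z powi (x j - m)) = 0"
      proof -
        have "(\<Sum>j\<in>I. q j * z powi (x j - m)) + (\<Sum>j\<in>J - I. q j * z powi (x j - m)) =
            (\<Sum>j\<in>J. q j * z powi (x j - m))"
          using J I by (subst sum.subset_diff[of I J]) auto
        then show ?thesis using x unfolding sum_e shift[of J] by (simp add: sol_def)
      qed
      \<comment> \<open>If all exponents outside \<open>I\<close> were at least \<open>G\<close>
        above \<open>m\<close>, the total could not vanish. Hence some index outside
        \<open>I\<close> belongs to \<open>low x D'\<close>.\<close>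
      ultimately have "\<not> (\<forall>j\<in>J - I. G \<le> x j - m)"
        using G[of "(I, e)", unfolded Q_def fst_conv snd_conv, THEN mp,
            THEN spec[of _ "\<lambda>j. x j - m"]] by blast
      then obtain j where j: "j \<in> J - I" "\<not> G \<le> x j - m" by blast
      then have "insert j I \<subseteq> low x D'"
        by (auto simp: I_def low_def D'_def m_def)
      moreover have fin: "finite (low x D')" using J by (auto simp: low_def)
      ultimately have "card (insert j I) \<le> card (low x D')" by (intro card_mono)
      moreover have "finite I" using I J by (meson finite_subset psubset_imp_subset)
      ultimately have "Suc (card I) \<le> card (low x D')" using j by simp
      then show ?thesis using D(2)[OF x J0] by (simp add: I_def)
    qed
    moreover have "D' \<ge> 0" using D(1) by (simp add: D'_def)
    ultimately show ?case by blast
  qed (auto intro: exI[of _ 0])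
  \<comment> \<open>The instance \<open>n = card J\<close>.\<close>
  then obtain D where D: "\<And>x. sol x \<Longrightarrow> J \<noteq> {} \<Longrightarrow> card J \<le> card (low x D)"
    by (metis min.idem)
  show ?thesis
  proof (intro exI[of _ D] allI impI ballI)
    fix x i j
    assume x: "(\<Sum>j\<in>J. q j * z powi x j) = 0"
      "\<forall>I. I \<subset> J \<longrightarrow> I \<noteq> {} \<longrightarrow> (\<Sum>j\<in>I. q j * z powi x j) \<noteq> 0"
      and ij: "i \<in> J" "j \<in> J"
    have "card J \<le> card (low x D)" using x ij by (intro D) (auto simp: sol_def)
    moreover have "low x D \<subseteq> J" by (auto simp: low_def)
    ultimately have "low x D = J" using J by (intro card_seteq) auto
    then have "x i - Min (x ` J) \<le> D" "x j - Min (x ` J) \<le> D"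
      using ij by (auto simp: low_def)
    moreover have "Min (x ` J) \<le> x i" "Min (x ` J) \<le> x j" using J ij by auto
    ultimately show "\<bar>x i - x j\<bar> \<le> D" by linarith
  qed
qed

text \<open>A solution is split into indecomposable vanishing subsums. The relation \<open>E\<close>
  encodes this splitting by the pairs whose exponent differences are to be kept; unlike a partition,
  it is combined from two parts by a plain union.\<close>

lemma zero_sum_cluster:
  fixes q :: "nat \<Rightarrow> 'a :: field_char_0"
  assumes z: "gap z" "z \<noteq> 0" and J: "finite J" and q: "\<And>j. j \<in> J \<Longrightarrow> q j \<in> laurent z"
  shows "\<exists>D :: int. \<forall>x. (\<Sum>j\<in>J. q j * z powi x j) = 0 \<longrightarrow>
    (\<exists>E \<subseteq> J \<times> J. (\<forall>(i, j)\<in>E. \<bar>x i - x j\<bar> \<le> D) \<and>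
      (\<forall>y. (\<forall>(i, j)\<in>E. y i - y j = x i - x j) \<longrightarrow> (\<Sum>j\<in>J. q j * z powi y j) = 0))"
  using J q
proof (induction J rule: finite_psubset_induct)
  case (psubset J)
  define good where "good = (\<lambda>x E I D. E \<subseteq> I \<times> I \<and> (\<forall>(i, j)\<in>E. \<bar>x i - x j\<bar> \<le> (D :: int)) \<and>
      (\<forall>y. (\<forall>(i, j)\<in>E. y i - y j = x i - x j) \<longrightarrow> (\<Sum>j\<in>I. q j * z powi y j) = 0))"
  have good_mono: "good x E I D'" if "good x E I D" "D \<le> D'" for x E I D D'
    using that unfolding good_def by fastforce
  have IH: "\<exists>D. \<forall>x. (\<Sum>j\<in>I. q j * z powi x j) = 0 \<longrightarrow> (\<exists>E. good x E I D)" if "I \<subset> J" for I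
  proof -
    have "\<And>j. j \<in> I \<Longrightarrow> q j \<in> laurent z" using psubset.prems that by blast
    from psubset.IH[OF that this] show ?thesis unfolding good_def .
  qed
  have "finite {I. I \<subset> J}"
    by (rule finite_subset[of _ "Pow J"]) (use psubset.hyps in auto)
  then have "\<exists>D. \<forall>I\<in>{I. I \<subset> J}. \<forall>x. (\<Sum>j\<in>I. q j * z powi x j) = 0 \<longrightarrow> (\<exists>E. good x E I D)"
  proof (rule finite_uniform_bound)
    fix I D D' assume "\<forall>x. (\<Sum>j\<in>I. q j * z powi x j) = 0 \<longrightarrow> (\<exists>E. good x E I D)" "D \<le> D'"
    then show "\<forall>x. (\<Sum>j\<in>I. q j * z powi x j) = 0 \<longrightarrow> (\<exists>E. good x E I D')"
      using good_mono by meson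
  qed (use IH in simp)
  then obtain D1 where D1: "\<And>I x. I \<subset> J \<Longrightarrow> (\<Sum>j\<in>I. q j * z powi x j) = 0 \<Longrightarrow> \<exists>E. good x E I D1"
    by blast
  obtain D2 where D2: "\<forall>x. (\<Sum>j\<in>J. q j * z powi x j) = 0 \<longrightarrow>
       (\<forall>I. I \<subset> J \<longrightarrow> I \<noteq> {} \<longrightarrow> (\<Sum>j\<in>I. q j * z powi x j) \<noteq> 0) \<longrightarrow>
       (\<forall>i\<in>J. \<forall>j\<in>J. \<bar>x i - x j\<bar> \<le> D2)"
    using indecomposable_zero_sum_spread[of z J q, OF z psubset.hyps psubset.prems] ..
  have "\<exists>E. good x E J (max D1 D2)" if x: "(\<Sum>j\<in>J. q j * z powi x j) = 0" for x
  proof (cases "\<exists>I. I \<subset> J \<and> I \<noteq> {} \<and> (\<Sum>j\<in>I. q j * z powi x j) = 0")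
    \<comment> \<open>The complement of a vanishing subsum vanishes too, and both index sets are
      proper subsets of \<open>J\<close>.\<close>
    case True
    then obtain I where I: "I \<subset> J" "I \<noteq> {}" "(\<Sum>j\<in>I. q j * z powi x j) = 0" by blast
    have split: "(\<Sum>j\<in>J. q j * z powi y j) =
        (\<Sum>j\<in>J - I. q j * z powi y j) + (\<Sum>j\<in>I. q j * z powi y j)" for y
      using I psubset.hyps by (intro sum.subset_diff) auto
    have "J - I \<subset> J" "(\<Sum>j\<in>J - I. q j * z powi x j) = 0"
      using I x split[of x] by auto
    then obtain E' where E': "good x E' (J - I) D1"
      using D1[of "J - I" x] by blast
    obtain E where E: "good x E I D1"
      using D1[of I x] I by blast
    have "good x (E \<union> E') J D1"
      unfolding good_def
    proof (intro conjI allI impI)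
      show "E \<union> E' \<subseteq> J \<times> J" using E E' I(1) unfolding good_def by blast
      show "\<forall>(i, j)\<in>E \<union> E'. \<bar>x i - x j\<bar> \<le> D1" using E E' unfolding good_def by blast
      fix y assume "\<forall>(i, j)\<in>E \<union> E'. y i - y j = x i - x j"
      then have "(\<Sum>j\<in>J - I. q j * z powi y j) = 0" "(\<Sum>j\<in>I. q j * z powi y j) = 0"
        using E E' unfolding good_def by blast+
      then show "(\<Sum>j\<in>J. q j * z powi y j) = 0" by (simp add: split)
    qed
    then show ?thesis using good_mono by (meson max.cobounded1)
  next
    case False
    \<comment> \<open>Here all differences are kept, so on \<open>J\<close> the tuple
      \<open>y\<close> is a translate of \<open>x\<close> and the sum is multiplied by a power of
      \<open>z\<close>.\<close>
    have "good x (J \<times> J) J D2"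
      unfolding good_def
    proof (intro conjI allI impI)
      have "\<forall>i\<in>J. \<forall>j\<in>J. \<bar>x i - x j\<bar> \<le> D2"
        using D2[rule_format, OF x] False by blast
      then show "\<forall>(i, j)\<in>J \<times> J. \<bar>x i - x j\<bar> \<le> D2" by blast
      fix y assume y: "\<forall>(i, j)\<in>J \<times> J. y i - y j = x i - x j"
      show "(\<Sum>j\<in>J. q j * z powi y j) = 0"
      proof (cases "J = {}")
        case False
        then obtain i where i: "i \<in> J" by blast
        have "(\<Sum>j\<in>J. q j * z powi y j) = (\<Sum>j\<in>J. z powi (y i - x i) * (q j * z powi x j))"
        proof (intro sum.cong refl)
          fix j assume "j \<in> J"
          then have "y j = y i - x i + x j" using y i by force
          then show "q j * z powi y j = z powi (y i - x i) * (q j * z powi x j)"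
            using z(2) by (simp add: power_int_add)
        qed
        also have "\<dots> = 0" using x by (simp flip: sum_distrib_left)
        finally show ?thesis .
      qed simp
    qed simp
    then show ?thesis using good_mono by (meson max.cobounded2)
  qed
  then show ?case unfolding good_def by blast
qed

section \<open>Finite unions of cosets\<close>

definition is_coset :: "nat \<Rightarrow> (nat \<Rightarrow> int) set \<Rightarrow> bool" where
  "is_coset k C \<longleftrightarrow> (\<exists>\<delta> A. \<delta> \<in> carrier (int_tuples k) \<and> subgroup A (int_tuples k) \<and>
     C = \<delta> <#\<^bsub>int_tuples k\<^esub> A)"

section \<open>The group of integer tuples and its cosets\<close>

lemma group_int_tuples: "group (int_tuples k)"
  by (simp add: int_tuples_def)

lemma carrier_int_tuples: "carrier (int_tuples k) = {1..k} \<rightarrow>\<^sub>E UNIV"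
  by (simp add: int_tuples_def)

lemma mult_int_tuples: "x \<otimes>\<^bsub>int_tuples k\<^esub> y = (\<lambda>i\<in>{1..k}. x i + y i)"
  by (simp add: int_tuples_def)

lemma one_int_tuples: "\<one>\<^bsub>int_tuples k\<^esub> = (\<lambda>i\<in>{1..k}. 0)"
  by (simp add: int_tuples_def)

lemma inv_int_tuples:
  "x \<in> carrier (int_tuples k) \<Longrightarrow> inv\<^bsub>int_tuples k\<^esub> x = (\<lambda>i\<in>{1..k}. - x i)"
  by (simp add: int_tuples_def)

lemma subgroup_int_tuplesI:
  assumes "A \<subseteq> carrier (int_tuples k)" "(\<lambda>i\<in>{1..k}. 0) \<in> A"
    and "\<And>x y. x \<in> A \<Longrightarrow> y \<in> A \<Longrightarrow> (\<lambda>i\<in>{1..k}. x i - y i) \<in> A"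
  shows "subgroup A (int_tuples k)"
proof -
  have neg: "(\<lambda>i\<in>{1..k}. - x i) \<in> A" if "x \<in> A" for x
    using assms(3)[OF assms(2) that] by (simp cong: restrict_cong)
  have "(\<lambda>i\<in>{1..k}. x i + y i) \<in> A" if "x \<in> A" "y \<in> A" for x y
    using assms(3)[OF that(1) neg[OF that(2)]] by (simp cong: restrict_cong)
  then show ?thesis
    using assms(1,2) neg
    by (intro group.subgroupI[OF group_int_tuples]) (auto simp: mult_int_tuples inv_int_tuples subset_iff)
qed

lemma mem_l_coset_int_tuples:
  assumes "A \<subseteq> carrier (int_tuples k)" and x: "x \<in> carrier (int_tuples k)"
  shows "y \<in> x <#\<^bsub>int_tuples k\<^esub> A \<longleftrightarrow>
    y \<in> carrier (int_tuples k) \<and> (\<lambda>i\<in>{1..k}. y i - x i) \<in> A"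
proof
  assume "y \<in> x <#\<^bsub>int_tuples k\<^esub> A"
  then obtain a where a: "a \<in> A" "y = (\<lambda>i\<in>{1..k}. x i + a i)"
    by (auto simp: l_coset_def mult_int_tuples)
  have "(\<lambda>i\<in>{1..k}. y i - x i) = a"
    using a assms by (auto simp: carrier_int_tuples PiE_iff extensional_def fun_eq_iff)
  then show "y \<in> carrier (int_tuples k) \<and> (\<lambda>i\<in>{1..k}. y i - x i) \<in> A"
    using a by (simp add: carrier_int_tuples)
next
  assume y: "y \<in> carrier (int_tuples k) \<and> (\<lambda>i\<in>{1..k}. y i - x i) \<in> A"
  then have "y = x \<otimes>\<^bsub>int_tuples k\<^esub> (\<lambda>i\<in>{1..k}. y i - x i)"
    by (auto simp: mult_int_tuples carrier_int_tuples PiE_iff extensional_def fun_eq_iff)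
  then show "y \<in> x <#\<^bsub>int_tuples k\<^esub> A" using y by (auto simp: l_coset_def)
qed

text \<open>Removes the enumeration by \<open>{1..n}\<close>, so that cosets can be collected by
  images and pairwise intersections of finite sets.\<close>

lemma semilinear_iff:
  "semilinear k S \<longleftrightarrow> (\<exists>\<C>. finite \<C> \<and> (\<forall>C\<in>\<C>. is_coset k C) \<and> S = \<Union>\<C>)"
proof
  assume "semilinear k S"
  then obtain n :: nat and \<delta> A where
    "\<forall>i\<in>{1..n}. \<delta> i \<in> carrier (int_tuples k)" "\<forall>i\<in>{1..n}. subgroup (A i) (int_tuples k)"
    "S = (\<Union>i\<in>{1..n}. \<delta> i <#\<^bsub>int_tuples k\<^esub> A i)"
    unfolding semilinear_def by blast
  then show "\<exists>\<C>. finite \<C> \<and> (\<forall>C\<in>\<C>. is_coset k C) \<and> S = \<Union>\<C>"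
    by (intro exI[of _ "(\<lambda>i. \<delta> i <#\<^bsub>int_tuples k\<^esub> A i) ` {1..n}"]) (auto simp: is_coset_def)
next
  assume "\<exists>\<C>. finite \<C> \<and> (\<forall>C\<in>\<C>. is_coset k C) \<and> S = \<Union>\<C>"
  then obtain \<C> where C: "finite \<C>" "\<And>C. C \<in> \<C> \<Longrightarrow> is_coset k C" "S = \<Union>\<C>" by blast
  obtain h where h: "bij_betw h {1..card \<C>} \<C>"
    using ex_bij_betw_nat_finite_1[OF C(1)] by blast
  have "\<forall>i\<in>{1..card \<C>}. \<exists>p. fst p \<in> carrier (int_tuples k) \<and>
      subgroup (snd p) (int_tuples k) \<and> h i = fst p <#\<^bsub>int_tuples k\<^esub> snd p"
    using C(2) bij_betwE[OF h] unfolding is_coset_def by fastforce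
  from bchoice[OF this] obtain p where p: "\<forall>i\<in>{1..card \<C>}. fst (p i) \<in> carrier (int_tuples k) \<and>
      subgroup (snd (p i)) (int_tuples k) \<and> h i = fst (p i) <#\<^bsub>int_tuples k\<^esub> snd (p i)"
    ..
  have "S = (\<Union>i\<in>{1..card \<C>}. h i)"
    unfolding C(3) bij_betw_imp_surj_on[OF h] ..
  also have "\<dots> = (\<Union>i\<in>{1..card \<C>}. fst (p i) <#\<^bsub>int_tuples k\<^esub> snd (p i))"
    using p by (intro SUP_cong) auto
  finally show "semilinear k S"
    unfolding semilinear_def using p
    by (intro exI[of _ "card \<C>"] exI[of _ "fst \<circ> p"] exI[of _ "snd \<circ> p"] conjI) simp_all
qed

lemma semilinear_carrier: "semilinear k (carrier (int_tuples k))"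
proof -
  have "is_coset k (carrier (int_tuples k))"
    unfolding is_coset_def
  proof (intro exI conjI)
    show one: "\<one>\<^bsub>int_tuples k\<^esub> \<in> carrier (int_tuples k)"
      using group.is_monoid[OF group_int_tuples] by (rule monoid.one_closed)
    show "subgroup (carrier (int_tuples k)) (int_tuples k)"
      by (rule group.subgroup_self[OF group_int_tuples])
    show "carrier (int_tuples k) = \<one>\<^bsub>int_tuples k\<^esub> <#\<^bsub>int_tuples k\<^esub> carrier (int_tuples k)"
      using mem_l_coset_int_tuples[OF subset_refl one]
      by (auto simp: carrier_int_tuples)
  qed
  then show ?thesis unfolding semilinear_iff by (intro exI[of _ "{carrier (int_tuples k)}"]) simp
qed

text \<open>A common element \<open>x\<close> represents both cosets, and translation by
  \<open>x\<close> commutes with intersecting the two subgroups.\<close>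

lemma is_coset_Int:
  assumes "is_coset k C" "is_coset k D" "C \<inter> D \<noteq> {}"
  shows "is_coset k (C \<inter> D)"
proof -
  interpret group "int_tuples k" by (rule group_int_tuples)
  obtain \<delta> A \<epsilon> B where A: "\<delta> \<in> carrier (int_tuples k)" "subgroup A (int_tuples k)"
      "C = \<delta> <#\<^bsub>int_tuples k\<^esub> A"
    and B: "\<epsilon> \<in> carrier (int_tuples k)" "subgroup B (int_tuples k)"
      "D = \<epsilon> <#\<^bsub>int_tuples k\<^esub> B"
    using assms(1,2) by (auto simp: is_coset_def)
  obtain x where x: "x \<in> C" "x \<in> D" using assms(3) by blast
  have x_carrier: "x \<in> carrier (int_tuples k)"
    using x(1) A by (metis l_coset_carrier)
  have C: "C = x <#\<^bsub>int_tuples k\<^esub> A"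
    using x(1) A by (metis l_repr_independence)
  have D: "D = x <#\<^bsub>int_tuples k\<^esub> B"
    using x(2) B by (metis l_repr_independence)
  have "C \<inter> D = x <#\<^bsub>int_tuples k\<^esub> (A \<inter> B)"
    unfolding C D
  proof (rule Set.set_eqI)
    fix y
    show "y \<in> (x <#\<^bsub>int_tuples k\<^esub> A) \<inter> (x <#\<^bsub>int_tuples k\<^esub> B) \<longleftrightarrow>
        y \<in> x <#\<^bsub>int_tuples k\<^esub> (A \<inter> B)"
      unfolding Int_iff mem_l_coset_int_tuples[OF subgroup.subset[OF A(2)] x_carrier]
        mem_l_coset_int_tuples[OF subgroup.subset[OF B(2)] x_carrier]
        mem_l_coset_int_tuples[OF subgroup.subset[OF subgroups_Inter_pair[OF A(2) B(2)]] x_carrier]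
      by blast
  qed
  then show ?thesis
    unfolding is_coset_def using x_carrier subgroups_Inter_pair[OF A(2) B(2)] by blast
qed

lemma semilinear_Int:
  assumes "semilinear k S" "semilinear k T"
  shows "semilinear k (S \<inter> T)"
proof -
  obtain \<C> \<D> where C: "finite \<C>" "\<forall>C\<in>\<C>. is_coset k C" "S = \<Union>\<C>"
    and D: "finite \<D>" "\<forall>D\<in>\<D>. is_coset k D" "T = \<Union>\<D>"
    using assms by (auto simp: semilinear_iff)
  \<comment> \<open>The empty set is not a coset, so empty intersections are discarded.\<close>
  let ?E = "(\<lambda>(C, D). C \<inter> D) ` (\<C> \<times> \<D>) - {{}}"
  have "finite ?E" using C(1) D(1) by simp
  moreover have "\<forall>E\<in>?E. is_coset k E" using C(2) D(2) by (auto intro!: is_coset_Int)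
  moreover have "S \<inter> T = \<Union>?E" using C(3) D(3) by auto
  ultimately show ?thesis unfolding semilinear_iff by blast
qed

section \<open>Criteria for semilinearity\<close>

lemma semilinear_if_finitely_many_cosets:
  assumes S: "S \<subseteq> carrier (int_tuples k)"
    and A: "\<And>x. x \<in> S \<Longrightarrow> subgroup (A x) (int_tuples k)"
    and sub: "\<And>x. x \<in> S \<Longrightarrow> x <#\<^bsub>int_tuples k\<^esub> A x \<subseteq> S"
    and fin: "finite ((\<lambda>x. x <#\<^bsub>int_tuples k\<^esub> A x) ` S)"
  shows "semilinear k S"
proof -
  \<comment> \<open>Each \<open>x\<close> lies in its own coset because \<open>A x\<close> contains
    zero. Different points may share a coset; only the distinct cosets have to be finite in
    number.\<close>
  have "x \<in> x <#\<^bsub>int_tuples k\<^esub> A x" if "x \<in> S" for x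
    using mem_l_coset_int_tuples[OF subgroup.subset[OF A[OF that]], of x x] that S
      subgroup.one_closed[OF A[OF that]] by (auto simp: one_int_tuples)
  then have "S = \<Union>((\<lambda>x. x <#\<^bsub>int_tuples k\<^esub> A x) ` S)"
    using sub by blast
  moreover have "\<forall>C\<in>(\<lambda>x. x <#\<^bsub>int_tuples k\<^esub> A x) ` S. is_coset k C"
    using A S by (auto simp: is_coset_def)
  ultimately show ?thesis unfolding semilinear_iff using fin by blast
qed

text \<open>A coset of the tuples divisible by \<open>n\<close> is determined by residues modulo
  \<open>n\<close>. This serves roots of unity, whose powers depend only on the exponent modulo
  \<open>n\<close>.\<close>

lemma semilinear_congruence_closed:
  assumes S: "S \<subseteq> carrier (int_tuples k)" and n: "n > 0"
    and closed: "\<And>x y. x \<in> S \<Longrightarrow> y \<in> carrier (int_tuples k) \<Longrightarrow>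
      (\<And>i. i \<in> {1..k} \<Longrightarrow> int n dvd y i - x i) \<Longrightarrow> y \<in> S"
  shows "semilinear k S"
proof -
  define A where "A = {a \<in> carrier (int_tuples k). \<forall>i\<in>{1..k}. int n dvd a i}"
  have A: "subgroup A (int_tuples k)"
    by (rule subgroup_int_tuplesI) (auto simp: A_def carrier_int_tuples)
  have coset: "x <#\<^bsub>int_tuples k\<^esub> A = {y \<in> carrier (int_tuples k). \<forall>i\<in>{1..k}. int n dvd y i - x i}"
    if "x \<in> S" for x
    using mem_l_coset_int_tuples[OF subgroup.subset[OF A], of x] that S
    by (auto simp: A_def carrier_int_tuples)
  have "(\<lambda>x. x <#\<^bsub>int_tuples k\<^esub> A) ` S \<subseteq>
    (\<lambda>r. {y \<in> carrier (int_tuples k). \<forall>i\<in>{1..k}. y i mod int n = r i}) ` ({1..k} \<rightarrow>\<^sub>E {0..<int n})"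
  proof (rule image_subsetI)
    fix x assume "x \<in> S"
    then show "x <#\<^bsub>int_tuples k\<^esub> A \<in>
        (\<lambda>r. {y \<in> carrier (int_tuples k). \<forall>i\<in>{1..k}. y i mod int n = r i}) ` ({1..k} \<rightarrow>\<^sub>E {0..<int n})"
      using n by (intro image_eqI[of _ _ "\<lambda>i\<in>{1..k}. x i mod int n"])
        (auto simp: coset mod_eq_dvd_iff)
  qed
  then have "finite ((\<lambda>x. x <#\<^bsub>int_tuples k\<^esub> A) ` S)"
    by (rule finite_subset) (intro finite_imageI finite_PiE, simp_all)
  then show ?thesis
    using A coset closed by (intro semilinear_if_finitely_many_cosets[OF S, of "\<lambda>_. A"]) auto
qed

text \<open>The coset attached to \<open>x\<close> depends only on the relation \<open>E\<close> and
  the differences of \<open>x\<close> along it. Both range over finite sets, as the indices are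
  finite in number and the differences lie in \<open>{- D..D}\<close>.\<close>

lemma semilinear_bounded_differences:
  assumes S: "S \<subseteq> carrier (int_tuples k)"
    and rel: "\<And>x. x \<in> S \<Longrightarrow> \<exists>E \<subseteq> {1..k} \<times> {1..k}. (\<forall>(i, j)\<in>E. \<bar>x i - x j\<bar> \<le> D) \<and>
      (\<forall>y\<in>carrier (int_tuples k). (\<forall>(i, j)\<in>E. y i - y j = x i - x j) \<longrightarrow> y \<in> S)"
  shows "semilinear k S"
proof -
  have "\<forall>x\<in>S. \<exists>E. E \<subseteq> {1..k} \<times> {1..k} \<and> (\<forall>(i, j)\<in>E. \<bar>x i - x j\<bar> \<le> D) \<and>
      (\<forall>y\<in>carrier (int_tuples k). (\<forall>(i, j)\<in>E. y i - y j = x i - x j) \<longrightarrow> y \<in> S)"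
    by (rule ballI) (rule rel)
  from bchoice[OF this] obtain E where E: "\<forall>x\<in>S. E x \<subseteq> {1..k} \<times> {1..k} \<and>
      (\<forall>(i, j)\<in>E x. \<bar>x i - x j\<bar> \<le> D) \<and>
      (\<forall>y\<in>carrier (int_tuples k). (\<forall>(i, j)\<in>E x. y i - y j = x i - x j) \<longrightarrow> y \<in> S)"
    ..
  have E_sub: "E x \<subseteq> {1..k} \<times> {1..k}" and E_bound: "\<forall>(i, j)\<in>E x. \<bar>x i - x j\<bar> \<le> D"
    and E_closed: "\<And>y. y \<in> carrier (int_tuples k) \<Longrightarrow>
      \<forall>(i, j)\<in>E x. y i - y j = x i - x j \<Longrightarrow> y \<in> S" if "x \<in> S" for x
    using E[rule_format, OF that] by blast+
  \<comment> \<open>The directions that leave all differences along \<open>E x\<close>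
    unchanged.\<close>
  define A where "A = (\<lambda>x. {a \<in> carrier (int_tuples k). \<forall>(i, j)\<in>E x. a i = a j})"
  have A: "subgroup (A x) (int_tuples k)" if x: "x \<in> S" for x
  proof (rule subgroup_int_tuplesI)
    show "A x \<subseteq> carrier (int_tuples k)" by (auto simp: A_def)
    have in_range: "i \<in> {1..k}" "j \<in> {1..k}" if "(i, j) \<in> E x" for i j
      using E_sub[OF x] that by blast+
    show "(\<lambda>i\<in>{1..k}. 0) \<in> A x"
      using in_range by (auto simp: A_def carrier_int_tuples simp del: atLeastAtMost_iff)
    fix a b assume "a \<in> A x" "b \<in> A x"
    then have "a i = a j" "b i = b j" if "(i, j) \<in> E x" for i j
      using that unfolding A_def by blast+
    then have "a i - b i = a j - b j" if "(i, j) \<in> E x" for i j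
      using that by metis
    then show "(\<lambda>i\<in>{1..k}. a i - b i) \<in> A x"
      using in_range by (auto simp: A_def carrier_int_tuples simp del: atLeastAtMost_iff)
  qed
  have coset: "x <#\<^bsub>int_tuples k\<^esub> A x =
      {y \<in> carrier (int_tuples k). \<forall>(i, j)\<in>E x. y i - y j = x i - x j}" if x: "x \<in> S" for x
  proof (intro Set.set_eqI)
    fix y
    have "(\<forall>(i, j)\<in>E x. (\<lambda>i\<in>{1..k}. y i - x i) i = (\<lambda>i\<in>{1..k}. y i - x i) j) \<longleftrightarrow>
        (\<forall>(i, j)\<in>E x. y i - y j = x i - x j)"
    proof (intro ball_cong refl, clarify)
      fix i j assume "(i, j) \<in> E x"
      then have "i \<in> {1..k}" "j \<in> {1..k}" using E_sub[OF x] by blast+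
      then show "((\<lambda>i\<in>{1..k}. y i - x i) i = (\<lambda>i\<in>{1..k}. y i - x i) j) = (y i - y j = x i - x j)"
        by (auto simp del: atLeastAtMost_iff)
    qed
    moreover have "(\<lambda>i\<in>{1..k}. y i - x i) \<in> carrier (int_tuples k)"
      by (simp add: carrier_int_tuples)
    ultimately show "y \<in> x <#\<^bsub>int_tuples k\<^esub> A x \<longleftrightarrow>
        y \<in> {y \<in> carrier (int_tuples k). \<forall>(i, j)\<in>E x. y i - y j = x i - x j}"
      unfolding mem_l_coset_int_tuples[OF subgroup.subset[OF A[OF x]] subsetD[OF S x]]
      by (simp add: A_def)
  qed
  \<comment> \<open>Describes the cosets by finite data alone, without reference to the point
    \<open>x\<close>.\<close>
  define T where "T = (\<lambda>(F, d). {y \<in> carrier (int_tuples k). \<forall>(i, j)\<in>F. y i - y j = (d (i, j) :: int)})"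
  have "(\<lambda>x. x <#\<^bsub>int_tuples k\<^esub> A x) ` S \<subseteq>
      T ` (SIGMA F : Pow ({1..k} \<times> {1..k}). F \<rightarrow>\<^sub>E {- D..D})"
  proof (rule image_subsetI)
    fix x assume x: "x \<in> S"
    have "x <#\<^bsub>int_tuples k\<^esub> A x = T (E x, \<lambda>(i, j)\<in>E x. x i - x j)"
      unfolding coset[OF x] T_def by auto
    moreover have "(\<lambda>(i, j)\<in>E x. x i - x j) \<in> E x \<rightarrow>\<^sub>E {- D..D}"
      using E_bound[OF x] by (fastforce simp: abs_le_iff)
    ultimately show "x <#\<^bsub>int_tuples k\<^esub> A x \<in>
        T ` (SIGMA F : Pow ({1..k} \<times> {1..k}). F \<rightarrow>\<^sub>E {- D..D})"
      using E_sub[OF x] by blast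
  qed
  moreover have "finite (SIGMA F : Pow ({1..k} \<times> {1..k}). F \<rightarrow>\<^sub>E {- D..D})"
    by (intro finite_SigmaI finite_PiE) (auto intro: finite_subset)
  ultimately have "finite ((\<lambda>x. x <#\<^bsub>int_tuples k\<^esub> A x) ` S)"
    by (meson finite_imageI finite_subset)
  then show ?thesis
    using A coset E_closed by (intro semilinear_if_finitely_many_cosets[OF S, of A]) auto
qed

section \<open>Solution sets\<close>

lemma semilinear_zero_sum_gap:
  assumes z: "gap z" "z \<noteq> 0" and q: "\<And>j. j \<in> {1..k} \<Longrightarrow> q j \<in> laurent z"
  shows "semilinear k {x \<in> carrier (int_tuples k). (\<Sum>j=1..k. q j * z powi x j) = 0}"
    and "semilinear k {x \<in> carrier (int_tuples k). (\<Sum>j=1..k. q j * inverse z powi x j) = 0}"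
proof -
  obtain D where D: "\<forall>x. (\<Sum>j=1..k. q j * z powi x j) = 0 \<longrightarrow>
    (\<exists>E \<subseteq> {1..k} \<times> {1..k}. (\<forall>(i, j)\<in>E. \<bar>x i - x j\<bar> \<le> D) \<and>
      (\<forall>y. (\<forall>(i, j)\<in>E. y i - y j = x i - x j) \<longrightarrow> (\<Sum>j=1..k. q j * z powi y j) = 0))"
    using zero_sum_cluster[of z "{1..k}" q, OF z finite_atLeastAtMost q] ..
  show "semilinear k {x \<in> carrier (int_tuples k). (\<Sum>j=1..k. q j * z powi x j) = 0}"
  proof (rule semilinear_bounded_differences)
    fix x assume "x \<in> {x \<in> carrier (int_tuples k). (\<Sum>j=1..k. q j * z powi x j) = 0}"
    then obtain E where E: "E \<subseteq> {1..k} \<times> {1..k}" "\<forall>(i, j)\<in>E. \<bar>x i - x j\<bar> \<le> D"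
      "\<And>y. \<forall>(i, j)\<in>E. y i - y j = x i - x j \<Longrightarrow> (\<Sum>j=1..k. q j * z powi y j) = 0"
      using D[rule_format, of x] by blast
    then show "\<exists>E\<subseteq>{1..k} \<times> {1..k}. (\<forall>(i, j)\<in>E. \<bar>x i - x j\<bar> \<le> D) \<and>
        (\<forall>y\<in>carrier (int_tuples k). (\<forall>(i, j)\<in>E. y i - y j = x i - x j) \<longrightarrow>
          y \<in> {x \<in> carrier (int_tuples k). (\<Sum>j=1..k. q j * z powi x j) = 0})"
      by (intro exI[of _ E]) simp
  qed blast
  \<comment> \<open>Passing to the inverse negates the exponents, which preserves the bounds on
    their differences; so the same \<open>D\<close> works.\<close>
  have neg: "(\<Sum>j=1..k. q j * inverse z powi x j) = (\<Sum>j=1..k. q j * z powi - x j)" for x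
    by (simp add: power_int_minus power_int_inverse)
  show "semilinear k {x \<in> carrier (int_tuples k). (\<Sum>j=1..k. q j * inverse z powi x j) = 0}"
    unfolding neg
  proof (rule semilinear_bounded_differences)
    fix x assume "x \<in> {x \<in> carrier (int_tuples k). (\<Sum>j=1..k. q j * z powi - x j) = 0}"
    then obtain E where E: "E \<subseteq> {1..k} \<times> {1..k}" "\<forall>(i, j)\<in>E. \<bar>- x i - - x j\<bar> \<le> D"
      "\<And>y. \<forall>(i, j)\<in>E. y i - y j = - x i - - x j \<Longrightarrow> (\<Sum>j=1..k. q j * z powi y j) = 0"
      using D[rule_format, of "\<lambda>i. - x i"] by blast
    have "(\<Sum>j=1..k. q j * z powi - y j) = 0" if "\<forall>(i, j)\<in>E. y i - y j = x i - x j" for y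
      using that by (intro E(3)) force
    moreover have "\<forall>(i, j)\<in>E. \<bar>x i - x j\<bar> \<le> D"
      using E(2) by (simp add: abs_minus_commute)
    ultimately show "\<exists>E\<subseteq>{1..k} \<times> {1..k}. (\<forall>(i, j)\<in>E. \<bar>x i - x j\<bar> \<le> D) \<and>
        (\<forall>y\<in>carrier (int_tuples k). (\<forall>(i, j)\<in>E. y i - y j = x i - x j) \<longrightarrow>
          y \<in> {x \<in> carrier (int_tuples k). (\<Sum>j=1..k. q j * z powi - x j) = 0})"
      using E(1) by (intro exI[of _ E]) simp
  qed blast
qed

lemma semilinear_zero_sum_root_of_unity:
  fixes z :: "'a :: field_char_0"
  assumes n: "n > 0" "z ^ n = 1"
  shows "semilinear k {x \<in> carrier (int_tuples k). (\<Sum>j=1..k. q j * z powi x j) = 0}"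
proof (rule semilinear_congruence_closed[OF _ n(1)])
  fix x y
  assume x: "x \<in> {x \<in> carrier (int_tuples k). (\<Sum>j=1..k. q j * z powi x j) = 0}"
    and y: "y \<in> carrier (int_tuples k)" "\<And>i. i \<in> {1..k} \<Longrightarrow> int n dvd y i - x i"
  have z: "z \<noteq> 0" using n by (auto simp: power_0_left)
  have "(\<Sum>j=1..k. q j * z powi y j) = (\<Sum>j=1..k. q j * z powi x j)"
  proof (intro sum.cong refl)
    fix j assume "j \<in> {1..k}"
    then obtain t where "y j - x j = int n * t" using y(2) by blast
    then have "y j = x j + int n * t" by simp
    then show "q j * z powi y j = q j * z powi x j"
      using z n(2) by (simp add: power_int_add power_int_mult)
  qed
  then show "y \<in> {x \<in> carrier (int_tuples k). (\<Sum>j=1..k. q j * z powi x j) = 0}"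
    using x y by simp
qed blast

lemma semilinear_zero_sum:
  fixes z :: complex
  assumes z: "algebraic z" "z \<noteq> 0" and q: "\<And>j. j \<in> {1..k} \<Longrightarrow> q j \<in> int_adjoin z"
  shows "semilinear k {x \<in> carrier (int_tuples k). (\<Sum>j=1..k. q j * z powi x j) = 0}"
proof -
  have q': "q j \<in> laurent z" "q j \<in> laurent (inverse z)" if j: "j \<in> {1..k}" for j
  proof -
    obtain p where "q j = ieval p z" using q[OF j] by (auto simp: int_adjoin_def ieval_def)
    then show "q j \<in> laurent z" "q j \<in> laurent (inverse z)"
      using ieval_in_laurent ieval_in_laurent_inverse[OF z(2)] by auto
  qed
  from root_of_unity_or_gap[OF z] show ?thesis
  proof (elim disjE exE conjE)
    fix n :: nat assume "n > 0" "z ^ n = 1"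
    then show ?thesis by (rule semilinear_zero_sum_root_of_unity)
  next
    assume "gap z"
    then show ?thesis using z(2) q'(1) by (rule semilinear_zero_sum_gap)
  next
    assume "gap (inverse z)"
    \<comment> \<open>With \<open>inverse z\<close> as the base, the second claim concerns
      \<open>inverse (inverse z)\<close>, that is, \<open>z\<close> again.\<close>
    then show ?thesis using semilinear_zero_sum_gap(2)[of "inverse z" k q] z(2) q'(2) by simp
  qed
qed

theorem corollary6p2:
  fixes s k :: nat
    and \<alpha> :: "nat \<Rightarrow> complex"
    and q :: "nat \<Rightarrow> nat \<Rightarrow> complex"
  assumes "\<And>i. i \<in> {1..s} \<Longrightarrow> \<alpha> i \<in> Qbar - {0, 1}"
    and "\<And>i j. i \<in> {1..s} \<Longrightarrow> j \<in> {1..k} \<Longrightarrow> q i j \<in> int_adjoin (\<alpha> i)"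
    and "\<And>j. j \<in> {1..k} \<Longrightarrow> \<exists>i\<in>{1..s}. q i j \<noteq> 0"
  shows "semilinear k
    {x \<in> carrier (int_tuples k).
      \<forall>i\<in>{1..s}. (\<Sum>j=1..k. q i j * \<alpha> i powi x j) = 0}"
proof -
  \<comment> \<open>Equations are added one at a time; the empty system has the whole group as its
    solution set, which is a single coset.\<close>
  define S where "S = (\<lambda>I. {x \<in> carrier (int_tuples k).
      \<forall>i\<in>I. (\<Sum>j=1..k. q i j * \<alpha> i powi x j) = 0})"
  have "semilinear k (S I)" if "finite I" "I \<subseteq> {1..s}" for I
    using that
  proof (induction I)
    case empty
    then show ?case using semilinear_carrier by (simp add: S_def)
  next
    case (insert i I)
    have "S (insert i I) = S {i} \<inter> S I" by (auto simp: S_def)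
    moreover have "semilinear k (S {i})"
      using semilinear_zero_sum[of "\<alpha> i" k "q i"] assms(1)[of i] assms(2)[of i] insert.prems
      by (simp add: S_def Qbar_def)
    ultimately show ?case using insert by (simp add: semilinear_Int)
  qed
  then show ?thesis unfolding S_def by simp
qed

end
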